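(* If a space $X$ is SHD (respectively, WSHD), then $\mathcal P_{\mathrm{fin}}(X)$ is SHD (respectively, WSHD).
   Context: $\mathbb N$ is the set of positive integers. A space is a nonempty topological space; no separation axioms are assumed. A space $Y$ is SHD (selectively highly divergent) if for every sequence $\langle U_n:n\in\mathbb N\rangle$ of nonempty open subsets of $Y$ there are $y_n\in U_n$ such that $\langle y_n:n\in\mathbb N\rangle$ has no convergent subsequence. $Y$ is WSHD (weakly selectively highly divergent) if for every such sequence there are an infinite $A\subseteq\mathbb N$ and $y_n\in U_n$ for $n\in A$ such that $\langle y_n:n\in A\rangle$ has no convergent subsequence. $\mathcal P_{\mathrm{fin}}(X)$ is the set of nonempty finite subsets of $X$ with the Vietoris topology, which has as a basis the sets $[U_1,\ldots,U_n]=\{F:F\subseteq\bigcup_{j=1}^nU_j\text{ and }F\cap U_j\neq\varnothing\text{ for all }1\le j\le n\}$, with $n\in\mathbb N$ and $U_1,\dots,U_n$ nonempty open subsets of $X$. *)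

theory Defs
  imports "HOL-Analysis.Analysis"
begin

text \<open>
  Sequences are indexed by \<open>nat\<close>, starting at 0 instead of 1.
  A sequence indexed by an infinite set \<open>A\<close> of naturals is given by a total function whose
  values outside \<open>A\<close> are irrelevant; its subsequences are the \<open>y \<circ> r\<close> with \<open>r\<close> strictly
  increasing and with values in \<open>A\<close>. Limits need not be unique.
\<close>

definition has_convergent_subseq :: "'a topology \<Rightarrow> nat set \<Rightarrow> (nat \<Rightarrow> 'a) \<Rightarrow> bool" where
  "has_convergent_subseq Y A y \<longleftrightarrow>
     (\<exists>r l. strict_mono r \<and> range r \<subseteq> A \<and> limitin Y (y \<circ> r) l sequentially)"

definition SHD :: "'a topology \<Rightarrow> bool" where
  "SHD Y \<longleftrightarrow>
     (\<forall>U :: nat \<Rightarrow> 'a set. (\<forall>n. openin Y (U n) \<and> U n \<noteq> {}) \<longrightarrow>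
        (\<exists>y. (\<forall>n. y n \<in> U n) \<and> \<not> has_convergent_subseq Y UNIV y))"

definition WSHD :: "'a topology \<Rightarrow> bool" where
  "WSHD Y \<longleftrightarrow>
     (\<forall>U :: nat \<Rightarrow> 'a set. (\<forall>n. openin Y (U n) \<and> U n \<noteq> {}) \<longrightarrow>
        (\<exists>A y. infinite A \<and> (\<forall>n\<in>A. y n \<in> U n) \<and> \<not> has_convergent_subseq Y A y))"

text \<open>
  The set \<open>[U\<^sub>1, \<dots>, U\<^sub>n]\<close> depends only on the finite nonempty family \<open>\<U> = {U\<^sub>1, \<dots>, U\<^sub>n}\<close>.
\<close>

definition vietoris_box :: "'a set set \<Rightarrow> 'a set set" where
  "vietoris_box \<U> = {F. finite F \<and> F \<noteq> {} \<and> F \<subseteq> \<Union>\<U> \<and> (\<forall>U\<in>\<U>. F \<inter> U \<noteq> {})}"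

definition vietoris_basis :: "'a topology \<Rightarrow> 'a set set set" where
  "vietoris_basis X =
     {vietoris_box \<U> | \<U>. finite \<U> \<and> \<U> \<noteq> {} \<and> (\<forall>U\<in>\<U>. openin X U \<and> U \<noteq> {})}"

definition Pfin :: "'a topology \<Rightarrow> 'a set topology" where
  "Pfin X = topology (arbitrary union_of (\<lambda>B. B \<in> vietoris_basis X))"

lemma vietoris_box_Int:
  "vietoris_box \<U> \<inter> vietoris_box \<V> =
     vietoris_box ((\<lambda>U. U \<inter> \<Union>\<V>) ` \<U> \<union> (\<lambda>V. V \<inter> \<Union>\<U>) ` \<V>)" (is "?L = vietoris_box ?W")
proof (rule set_eqI)
  fix F
  have U: "\<Union>?W = \<Union>\<U> \<inter> \<Union>\<V>"
    by blast
  have "F \<inter> (U \<inter> \<Union>\<V>) = F \<inter> U" "F \<inter> (V \<inter> \<Union>\<U>) = F \<inter> V"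
    if "F \<subseteq> \<Union>\<U> \<inter> \<Union>\<V>" for U V
    using that by auto
  note eq = this
  show "F \<in> ?L \<longleftrightarrow> F \<in> vietoris_box ?W"
  proof (cases "F \<subseteq> \<Union>\<U> \<inter> \<Union>\<V>")
    case True
    then have "F \<subseteq> \<Union>\<U>" "F \<subseteq> \<Union>\<V>"
      by simp_all
    with True show ?thesis
      unfolding vietoris_box_def mem_Collect_eq Int_iff U
      by (simp only: ball_Un ball_simps eq) auto
  next
    case False
    then show ?thesis
      unfolding vietoris_box_def mem_Collect_eq Int_iff U by (simp only: le_inf_iff) metis
  qed
qed

lemma openin_Pfin: "openin (Pfin X) = arbitrary union_of (\<lambda>B. B \<in> vietoris_basis X)"
proof -
  have "(arbitrary union_of (\<lambda>B. B \<in> vietoris_basis X)) (S \<inter> T)"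
    if S: "S \<in> vietoris_basis X" and T: "T \<in> vietoris_basis X" for S T
  proof (cases "S \<inter> T = {}")
    case True
    then show ?thesis by (simp add: arbitrary_union_of_empty)
  next
    case False
    obtain \<U> \<V> where U: "S = vietoris_box \<U>" "finite \<U>" "\<U> \<noteq> {}" "\<And>U. U \<in> \<U> \<Longrightarrow> openin X U"
      and V: "T = vietoris_box \<V>" "finite \<V>" "\<And>V. V \<in> \<V> \<Longrightarrow> openin X V"
      using S T unfolding vietoris_basis_def by blast
    let ?W = "(\<lambda>U. U \<inter> \<Union>\<V>) ` \<U> \<union> (\<lambda>V. V \<inter> \<Union>\<U>) ` \<V>"
    have eq: "S \<inter> T = vietoris_box ?W"
      using U V by (simp add: vietoris_box_Int)
    have ne: "\<forall>W\<in>?W. W \<noteq> {}"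
      using False unfolding eq vietoris_box_def by blast
    have op: "\<forall>W\<in>?W. openin X W"
      using U V by (auto intro!: openin_Int openin_Union)
    have "finite ?W" "?W \<noteq> {}"
      using U V by auto
    with ne op have "S \<inter> T \<in> vietoris_basis X"
      unfolding eq vietoris_basis_def mem_Collect_eq by (intro exI[of _ ?W]) simp
    then show ?thesis by (simp add: arbitrary_union_of_inc)
  qed
  then have "istopology (arbitrary union_of (\<lambda>B. B \<in> vietoris_basis X))"
    unfolding istopology_base_eq by blast
  then show ?thesis
    unfolding Pfin_def by (rule topology_inverse')
qed

lemma topspace_Pfin: "topspace (Pfin X) = {F. finite F \<and> F \<noteq> {} \<and> F \<subseteq> topspace X}"
proof (intro equalityI subsetI)
  fix F assume "F \<in> topspace (Pfin X)"
  then obtain W where "openin (Pfin X) W" "F \<in> W"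
    unfolding topspace_def by blast
  then obtain B where "B \<in> vietoris_basis X" "F \<in> B"
    unfolding openin_Pfin union_of_def by blast
  then obtain \<U> where "F \<in> vietoris_box \<U>" "\<forall>U\<in>\<U>. openin X U"
    unfolding vietoris_basis_def by auto
  moreover from this have "\<Union>\<U> \<subseteq> topspace X"
    by (simp add: Union_least openin_subset)
  ultimately show "F \<in> {F. finite F \<and> F \<noteq> {} \<and> F \<subseteq> topspace X}"
    unfolding vietoris_box_def mem_Collect_eq by (metis subset_trans)
next
  fix F assume F: "F \<in> {F. finite F \<and> F \<noteq> {} \<and> F \<subseteq> topspace X}"
  then have "F \<in> vietoris_box {topspace X}"
    by (auto simp: vietoris_box_def)
  moreover have "vietoris_box {topspace X} \<in> vietoris_basis X"
    using F unfolding vietoris_basis_def mem_Collect_eq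
    by (intro exI[of _ "{topspace X}"]) auto
  then have "openin (Pfin X) (vietoris_box {topspace X})"
    by (simp add: openin_Pfin arbitrary_union_of_inc)
  ultimately show "F \<in> topspace (Pfin X)"
    using openin_subset by blast
qed

end

theory Submission
  imports Defs
begin

text \<open>
  Keep one point \<open>y\<^sub>n\<close> of each finite set \<open>F\<^sub>n\<close>. If a subsequence of the \<open>F\<^sub>n\<close> converges to a finite
  set \<open>F\<close>, then the corresponding points eventually lie in every open set containing \<open>F\<close>, and since
  \<open>F\<close> is finite, a further subsequence of the points converges to an element of \<open>F\<close>. So it is enough
  to choose the \<open>y\<^sub>n\<close> in \<open>X\<close> without convergent subsequence and to complete each of them arbitrarily
  to a member of the given open set of \<open>Pfin X\<close>.
\<close>

text \<open>Induction on \<open>F\<close>, removing one point \<open>a\<close> at a time. If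
  \<open>z\<close> does not converge to \<open>a\<close>, infinitely many terms avoid some open
  \<open>V\<close> around \<open>a\<close>, and the subsequence of these terms is attracted by the
  remaining points.\<close>

lemma finite_attractor_convergent_subseq:
  assumes "finite F" "F \<subseteq> topspace X"
    and "\<And>W. openin X W \<Longrightarrow> F \<subseteq> W \<Longrightarrow> \<forall>\<^sub>F i in sequentially. z i \<in> W"
  shows "\<exists>r a. strict_mono (r :: nat \<Rightarrow> nat) \<and> a \<in> F \<and> limitin X (z \<circ> r) a sequentially"
  using assms
proof (induction F arbitrary: z rule: finite_induct)
  case empty
  \<comment> \<open>The empty set is an open superset of \<open>F = {}\<close>, so
    \<open>z i\<close> would eventually lie in it, which is absurd.\<close>
  from empty.prems(2)[of "{}"] show ?case
    by simp
next
  case (insert a F)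
  show ?case
  proof (cases "limitin X z a sequentially")
    case True
    then show ?thesis
      by (intro exI[of _ id] exI[of _ a]) (simp add: strict_mono_def)
  next
    case False
    then obtain V where V: "openin X V" "a \<in> V" "\<not> (\<forall>\<^sub>F i in sequentially. z i \<in> V)"
      using insert.prems(1) unfolding limitin_def by auto
    have inf: "infinite {i. z i \<notin> V}"
      using V(3) by (simp add: eventually_cofinite flip: cofinite_eq_sequentially)
    obtain r :: "nat \<Rightarrow> nat" where r: "strict_mono r" "\<And>i. z (r i) \<notin> V"
      using infinite_enumerate[OF inf] by auto
    \<comment> \<open>\<open>W \<union> V\<close> is an open superset of \<open>insert a F\<close>;
      since \<open>z \<circ> r\<close> avoids \<open>V\<close>, its terms must eventually fall in
      \<open>W\<close>.\<close>
    have near: "\<forall>\<^sub>F i in sequentially. (z \<circ> r) i \<in> W" if W: "openin X W" "F \<subseteq> W" for W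
    proof -
      have "\<forall>\<^sub>F i in sequentially. z i \<in> W \<union> V"
        using W V by (intro insert.prems(2)) auto
      then have "\<forall>\<^sub>F i in sequentially. z (r i) \<in> W \<union> V"
        by (rule eventually_subseq[OF r(1)])
      then show ?thesis
        using r(2) by simp
    qed
    have "\<exists>s b. strict_mono s \<and> b \<in> F \<and> limitin X (z \<circ> r \<circ> s) b sequentially"
    proof (rule insert.IH)
      show "F \<subseteq> topspace X"
        using insert.prems(1) by simp
    qed (fact near)
    then obtain s b where "strict_mono s" "b \<in> F" "limitin X (z \<circ> r \<circ> s) b sequentially"
      by (elim exE conjE)
    then show ?thesis
      using strict_mono_o[OF r(1)]
      by (intro exI[of _ "r \<circ> s"] exI[of _ b]) (auto simp: o_def)
  qed
qed

text \<open>For open \<open>W\<close> containing the limit \<open>L\<close>, the box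
  \<open>vietoris_box {W}\<close> is a neighbourhood of \<open>L\<close>, which forces the sets, and
  hence the selected points, into \<open>W\<close> eventually. Finiteness of \<open>L\<close> then
  yields a convergent further subsequence.\<close>

lemma has_convergent_subseq_Pfin_selection:
  assumes conv: "has_convergent_subseq (Pfin X) A F" and y: "\<And>n. n \<in> A \<Longrightarrow> y n \<in> F n"
  shows "has_convergent_subseq X A y"
proof -
  obtain r L where r: "strict_mono r" "range r \<subseteq> A"
    and lim: "limitin (Pfin X) (F \<circ> r) L sequentially"
    using conv unfolding has_convergent_subseq_def by blast
  then have L: "finite L" "L \<noteq> {}" "L \<subseteq> topspace X"
    using limitin_topspace[OF lim] by (auto simp: topspace_Pfin)
  have "\<forall>\<^sub>F i in sequentially. (y \<circ> r) i \<in> W" if W: "openin X W" "L \<subseteq> W" for W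
  proof -
    have "vietoris_box {W} \<in> vietoris_basis X"
      using W L unfolding vietoris_basis_def by blast
    then have "openin (Pfin X) (vietoris_box {W})"
      by (simp add: openin_Pfin arbitrary_union_of_inc)
    moreover have "L \<in> vietoris_box {W}"
      using W L by (auto simp: vietoris_box_def)
    ultimately have "\<forall>\<^sub>F i in sequentially. (F \<circ> r) i \<in> vietoris_box {W}"
      using lim unfolding limitin_def by blast
    moreover have "(y \<circ> r) i \<in> (F \<circ> r) i" for i
      using y r(2) by auto
    ultimately show ?thesis
      by (auto simp: vietoris_box_def elim!: eventually_mono)
  qed
  then obtain s a where "strict_mono s" "limitin X (y \<circ> r \<circ> s) a sequentially"
    using finite_attractor_convergent_subseq[of L X "y \<circ> r"] L by blast
  moreover have "range (r \<circ> s) \<subseteq> A"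
    using r(2) by auto
  ultimately show ?thesis
    using r(1) unfolding has_convergent_subseq_def by (metis comp_assoc strict_mono_o)
qed

text \<open>Inside a basic box contained in \<open>W\<close>, fix one point in each of its finitely
  many open sets. Adding any further point of one of these sets keeps the finite set in the box, so
  that open set can serve as \<open>U\<close>.\<close>

lemma openin_Pfin_extend_point:
  assumes "openin (Pfin X) W" "W \<noteq> {}"
  shows "\<exists>U. openin X U \<and> U \<noteq> {} \<and> (\<forall>x\<in>U. \<exists>F\<in>W. x \<in> F)"
proof -
  obtain \<B> where "\<B> \<subseteq> vietoris_basis X" "\<Union>\<B> = W"
    using assms(1) unfolding openin_Pfin union_of_def by auto
  then obtain B where "B \<in> vietoris_basis X" and B: "B \<subseteq> W"
    using assms(2) by auto
  then obtain \<U> where \<U>: "B = vietoris_box \<U>" "finite \<U>" "\<U> \<noteq> {}"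
      "\<forall>U\<in>\<U>. openin X U \<and> U \<noteq> {}"
    unfolding vietoris_basis_def by auto
  then have "\<forall>U\<in>\<U>. \<exists>x. x \<in> U"
    by auto
  then obtain c where c: "\<And>U. U \<in> \<U> \<Longrightarrow> c U \<in> U"
    by metis
  obtain U where U: "U \<in> \<U>"
    using \<U>(3) by auto
  have "insert x (c ` \<U>) \<in> W" if "x \<in> U" for x
  proof -
    have "insert x (c ` \<U>) \<in> vietoris_box \<U>"
      using that U c \<U>(2) unfolding vietoris_box_def by auto
    with B \<U>(1) show ?thesis
      by auto
  qed
  then show ?thesis
    using U \<U>(4) by (intro exI[of _ U]) auto
qed

theorem corollary3p32:
  fixes X :: "'a topology"
  assumes "topspace X \<noteq> {}"
  shows "(SHD X \<longrightarrow> SHD (Pfin X)) \<and> (WSHD X \<longrightarrow> WSHD (Pfin X))"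
proof -
  \<comment> \<open>Here \<open>f n x\<close> is the completion of \<open>x\<close> to a member of
    \<open>W n\<close>, so that points can be chosen in \<open>X\<close> first.\<close>
  have shrink: "\<exists>U f. (\<forall>n. openin X (U n) \<and> U n \<noteq> {}) \<and> (\<forall>n. \<forall>x\<in>U n. f n x \<in> W n \<and> x \<in> f n x)"
    if "\<forall>n. openin (Pfin X) (W n) \<and> W n \<noteq> {}" for W :: "nat \<Rightarrow> 'a set set"
  proof -
    have "\<forall>n. \<exists>U. openin X U \<and> U \<noteq> {} \<and> (\<forall>x\<in>U. \<exists>F\<in>W n. x \<in> F)"
      using that by (intro allI openin_Pfin_extend_point) auto
    from choice[OF this] obtain U
      where U: "\<forall>n. openin X (U n) \<and> U n \<noteq> {} \<and> (\<forall>x\<in>U n. \<exists>F\<in>W n. x \<in> F)" ..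
    have "(SOME F. F \<in> W n \<and> x \<in> F) \<in> W n \<and> x \<in> (SOME F. F \<in> W n \<and> x \<in> F)"
      if "x \<in> U n" for n x
      by (rule someI_ex) (use U that in auto)
    with U show ?thesis
      by (intro exI[of _ U] exI[of _ "\<lambda>n x. SOME F. F \<in> W n \<and> x \<in> F"]) simp
  qed
  have "SHD (Pfin X)" if "SHD X"
    unfolding SHD_def
  proof (intro allI impI)
    fix W :: "nat \<Rightarrow> 'a set set"
    assume "\<forall>n. openin (Pfin X) (W n) \<and> W n \<noteq> {}"
    then obtain U f where U: "\<forall>n. openin X (U n) \<and> U n \<noteq> {}"
      and f: "\<forall>n. \<forall>x\<in>U n. f n x \<in> W n \<and> x \<in> f n x"
      using shrink[of W] by auto
    obtain y where "\<forall>n. y n \<in> U n" "\<not> has_convergent_subseq X UNIV y"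
      using \<open>SHD X\<close>[unfolded SHD_def, THEN spec, THEN mp, OF U] by auto
    then show "\<exists>F. (\<forall>n. F n \<in> W n) \<and> \<not> has_convergent_subseq (Pfin X) UNIV F"
      using f has_convergent_subseq_Pfin_selection[of X UNIV "\<lambda>n. f n (y n)" y]
      by (intro exI[of _ "\<lambda>n. f n (y n)"]) auto
  qed
  moreover have "WSHD (Pfin X)" if "WSHD X"
    unfolding WSHD_def
  proof (intro allI impI)
    fix W :: "nat \<Rightarrow> 'a set set"
    assume "\<forall>n. openin (Pfin X) (W n) \<and> W n \<noteq> {}"
    then obtain U f where U: "\<forall>n. openin X (U n) \<and> U n \<noteq> {}"
      and f: "\<forall>n. \<forall>x\<in>U n. f n x \<in> W n \<and> x \<in> f n x"
      using shrink[of W] by auto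
    obtain A y where "infinite A" "\<forall>n\<in>A. y n \<in> U n" "\<not> has_convergent_subseq X A y"
      using \<open>WSHD X\<close>[unfolded WSHD_def, THEN spec, THEN mp, OF U] by auto
    \<comment> \<open>For \<open>n\<close> outside \<open>A\<close> the value
      \<open>f n (y n)\<close> is arbitrary; membership of \<open>y n\<close> in it matters only on
      \<open>A\<close>.\<close>
    then show "\<exists>A F. infinite A \<and> (\<forall>n\<in>A. F n \<in> W n) \<and> \<not> has_convergent_subseq (Pfin X) A F"
      using f has_convergent_subseq_Pfin_selection[of X A "\<lambda>n. f n (y n)" y]
      by (intro exI[of _ A] exI[of _ "\<lambda>n. f n (y n)"]) auto
  qed
  ultimately show ?thesis
    by blast
qed

end
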